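(* Let $A_1,\dots,A_m\in\mathbb{R}^{n\times p}$. Consider the problem (Fair SVD) $$\max_{z\in\mathbb{R},\,X\in\mathcal{D}}\{z:\ z\le\langle A_i,X\rangle,\ \forall i\in[m]\},\qquad \mathcal{D}:=\{X\in\mathbb{R}^{n\times p}:\ \operatorname{rank}(X)\le k,\ \|X\|_2\le1\},$$ and its relaxation (Fair SVD-R) $$V_{\rm rel}:=\max_{z\in\mathbb{R},\,X\in\operatorname{conv}(\mathcal{D})}\{z:\ z\le\langle A_i,X\rangle,\ \forall i\in[m]\},\qquad \operatorname{conv}(\mathcal{D})=\{X\in\mathbb{R}^{n\times p}:\ \|X\|_*\le k,\ \|X\|_2\le1\}.$$ Then there exists an optimal solution $(z,X)$ of Fair SVD-R such that $X$ has rank at most $k+\lfloor\sqrt{2m+1/4}-3/2\rfloor$. Moreover, if $m\le2$, then Fair SVD-R yields the same optimal value as Fair SVD.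
   Context: $k\le n\le p$ and $m$ are positive integers; $[m]=\{1,\dots,m\}$; $\langle\cdot,\cdot\rangle$ is the Frobenius inner product; $\|X\|_2$ is the spectral norm (largest singular value) and $\|X\|_*$ the nuclear norm (sum of singular values); $\operatorname{conv}$ denotes convex hull. *)

theory Defs
  imports "HOL-Analysis.Analysis"
begin

text \<open>
  An \<open>n \<times> p\<close> real matrix is an element of \<^typ>\<open>real^'p^'n\<close> (rows indexed by \<open>'n\<close>).
  On this type the library's inner product \<open>A \<bullet> X = (\<Sum>i. A $ i \<bullet> X $ i)\<close> is the
  Frobenius inner product.
\<close>

text \<open>
  The singular values of \<open>X\<close> are the nonnegative square roots of the eigenvalues of the
  \<open>n \<times> n\<close> matrix \<open>X X\<^sup>T\<close>. This yields \<open>n\<close> of them, counted with multiplicity, which is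
  the usual convention when \<open>n \<le> p\<close>. Since \<open>X X\<^sup>T\<close> is symmetric, the multiplicity is the
  dimension of the eigenspace.
\<close>

definition singular_space :: "real^'p^'n \<Rightarrow> real \<Rightarrow> (real^'n) set" where
  "singular_space X s = {u. (X ** transpose X) *v u = s\<^sup>2 *\<^sub>R u}"

definition singular_values :: "real^'p^'n \<Rightarrow> real set" where
  "singular_values X = {s. 0 \<le> s \<and> (\<exists>u\<in>singular_space X s. u \<noteq> 0)}"

definition spectral_norm :: "real^'p^'n \<Rightarrow> real" where
  "spectral_norm X = Max (singular_values X)"

definition nuclear_norm :: "real^'p^'n \<Rightarrow> real" where
  "nuclear_norm X = (\<Sum>s\<in>singular_values X. real (dim (singular_space X s)) * s)"

definition rank_spectral_set :: "nat \<Rightarrow> (real^'p^'n) set" where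
  "rank_spectral_set k = {X. rank X \<le> k \<and> spectral_norm X \<le> 1}"

text \<open>
  Feasible pairs \<open>(z, X)\<close> of the problem of maximising \<open>z\<close> subject to \<open>X \<in> S\<close> and
  \<open>z \<le> \<langle>A\<^sub>i, X\<rangle>\<close> for all \<open>i \<in> [m]\<close>. Fair SVD is the case \<open>S = rank_spectral_set k\<close>,
  its relaxation Fair SVD-R the case \<open>S = convex hull (rank_spectral_set k)\<close>.
\<close>

definition fair_feasible ::
  "(nat \<Rightarrow> real^'p^'n) \<Rightarrow> nat \<Rightarrow> (real^'p^'n) set \<Rightarrow> (real \<times> (real^'p^'n)) set" where
  "fair_feasible A m S = {(z, X). X \<in> S \<and> (\<forall>i\<in>{1..m}. z \<le> A i \<bullet> X)}"

definition optimal_solution :: "(real \<times> 'a) set \<Rightarrow> real \<times> 'a \<Rightarrow> bool" where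
  "optimal_solution F = is_arg_max fst (\<lambda>q. q \<in> F)"

text \<open>The maximum is required to be attained, so there is at most one optimal value.\<close>

definition has_optimal_value :: "(real \<times> 'a) set \<Rightarrow> real \<Rightarrow> bool" where
  "has_optimal_value F v \<longleftrightarrow> (\<exists>X. optimal_solution F (v, X))"

definition fair_svd ::
  "(nat \<Rightarrow> real^'p^'n) \<Rightarrow> nat \<Rightarrow> nat \<Rightarrow> (real \<times> (real^'p^'n)) set" where
  "fair_svd A m k = fair_feasible A m (rank_spectral_set k)"

definition fair_svd_relaxed ::
  "(nat \<Rightarrow> real^'p^'n) \<Rightarrow> nat \<Rightarrow> nat \<Rightarrow> (real \<times> (real^'p^'n)) set" where
  "fair_svd_relaxed A m k = fair_feasible A m (convex hull (rank_spectral_set k))"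

end

theory Submission
  imports Defs
begin

text \<open>
  Let \<open>C\<close> be the set of matrices with nuclear norm at most \<open>k\<close> and spectral norm at most \<open>1\<close>.
  Everything rests on one question: when can \<open>X \<in> C\<close> be moved along a segment inside \<open>C\<close>?

  Take the polar decomposition \<open>X = T V\<close>, where \<open>T\<close> is positive semidefinite with the singular
  values of \<open>X\<close> as eigenvalues and \<open>V\<close> is a partial isometry. Let \<open>s\<close> be the number of singular
  values strictly between \<open>0\<close> and \<open>1\<close>. A symmetric matrix \<open>D\<close> supported on the corresponding
  eigenvectors may be added to \<open>T\<close> with a small factor of either sign: the result stays between
  \<open>0\<close> and the identity, and its trace, which is the nuclear norm, does not change if \<open>D\<close> is
  traceless. So \<open>X \<plusminus> \<epsilon> D V\<close> stays in \<open>C\<close>. Such \<open>D\<close> form a space of dimension \<open>s (s + 1) / 2\<close>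
  before the trace condition is imposed, hence one can also make \<open>D V\<close> orthogonal to \<open>q\<close>
  prescribed matrices unless \<open>s (s + 1) / 2 \<le> q + 1\<close>
  (\<open>perturbation_direction_exists\<close>).

  On the other hand, let \<open>a\<close> be the number of singular values equal to \<open>1\<close>, so that the rank is
  \<open>a + s\<close>. The nuclear norm is at least \<open>a\<close>, and strictly larger if \<open>s > 0\<close>; thus either the
  rank is at most \<open>k\<close>, or \<open>a \<le> k - 1\<close> and the rank is at most \<open>k - 1 + s\<close>
  (\<open>rank_le_fractional\<close>).

  For an extreme point of \<open>C\<close> apply this with \<open>q = 0\<close>: then \<open>s \<le> 1\<close> and the rank is at most \<open>k\<close>,
  and the Krein--Milman theorem gives the description of the convex hull. For the fair problem take an
  extreme point of the set of optimal matrices. A direction orthogonal to the \<open>m - 1\<close>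
  differences \<open>A i - A 1\<close> changes all \<open>m\<close> objectives by the same amount, which optimality
  forces to be zero; so \<open>q = m - 1\<close> and \<open>s (s + 1) / 2 \<le> m\<close>, which bounds
  \<open>s - 1\<close> by the floor in the theorem. If \<open>m \<le> 2\<close> then \<open>s \<le> 1\<close>, so this optimal matrix has rank at most
  \<open>k\<close> and also solves the unrelaxed problem.

  That \<open>C\<close> is compact and convex, and that \<open>T V\<close> lies in \<open>C\<close> when \<open>0 \<le> T \<le> 1\<close> and the trace
  of \<open>T\<close> is at most \<open>k\<close>, both follow from the dual description of the nuclear norm as
  the supremum of \<open>X \<bullet> Y\<close> over all contractions \<open>Y\<close>.
\<close>

section \<open>Orthonormal bases and the spectral theorem\<close>

definition orthonormal_basis :: "'a::euclidean_space set \<Rightarrow> bool" where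
  "orthonormal_basis B \<longleftrightarrow>
     finite B \<and> pairwise orthogonal B \<and> (\<forall>b\<in>B. norm b = 1) \<and> span B = UNIV"

lemma orthonormal_basis_inner:
  assumes "orthonormal_basis B" "b \<in> B" "c \<in> B"
  shows "b \<bullet> c = (if b = c then 1 else 0)"
  using assms by (auto simp: orthonormal_basis_def pairwise_def orthogonal_def norm_eq_1)

lemma orthonormal_basis_finite: "orthonormal_basis B \<Longrightarrow> finite B"
  by (simp add: orthonormal_basis_def)

lemma orthonormal_basis_expansion:
  assumes "orthonormal_basis B"
  shows "(\<Sum>b\<in>B. (b \<bullet> x) *\<^sub>R b) = x"
  using orthonormal_basis_expand[of B x] assms
  by (simp add: orthonormal_basis_def inner_commute)

lemma orthonormal_basis_eqI:
  assumes "orthonormal_basis B" "\<And>b. b \<in> B \<Longrightarrow> b \<bullet> x = b \<bullet> y"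
  shows "x = y"
proof -
  have "(\<Sum>b\<in>B. (b \<bullet> x) *\<^sub>R b) = (\<Sum>b\<in>B. (b \<bullet> y) *\<^sub>R b)"
    using assms(2) by simp
  then show ?thesis using orthonormal_basis_expansion[OF assms(1)] by metis
qed

lemma parseval:
  assumes "orthonormal_basis B"
  shows "x \<bullet> y = (\<Sum>b\<in>B. (b \<bullet> x) * (b \<bullet> y))"
proof -
  have "x \<bullet> y = (\<Sum>b\<in>B. (b \<bullet> x) *\<^sub>R b) \<bullet> y"
    using orthonormal_basis_expansion[OF assms] by simp
  then show ?thesis by (simp add: inner_sum_left)
qed

lemma orthonormal_basis_exists: "\<exists>B :: 'a::euclidean_space set. orthonormal_basis B"
  by (rule exI[of _ Basis])
    (auto simp: orthonormal_basis_def pairwise_def orthogonal_def inner_not_same_Basis)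

lemma orthonormal_basis_nonempty:
  assumes "orthonormal_basis (B :: 'a::euclidean_space set)"
  shows "B \<noteq> {}"
proof
  assume "B = {}"
  then have "(UNIV :: 'a set) = {0}" using assms by (simp add: orthonormal_basis_def)
  then show False using nonempty_Basis nonzero_Basis by blast
qed

text \<open>
  The Rayleigh quotient of a self-adjoint map attains its maximum on the unit sphere of an
  invariant subspace, and a maximiser is an eigenvector: perturbing it in a direction orthogonal
  to it changes the quotient to first order unless the image is parallel to it.
\<close>

lemma selfadjoint_eigenvector:
  fixes f :: "'a::euclidean_space \<Rightarrow> 'a"
  assumes f: "linear f" and sa: "\<And>x y. f x \<bullet> y = x \<bullet> f y"
    and S: "subspace S" "f ` S \<subseteq> S" "S \<noteq> {0}"
  obtains e c where "e \<in> S" "norm e = 1" "f e = c *\<^sub>R e"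
proof -
  let ?K = "S \<inter> sphere 0 1"
  obtain a where a: "a \<in> S" "a \<noteq> 0" using S subspace_0 by blast
  have "a /\<^sub>R norm a \<in> ?K" using a S by (simp add: subspace_scale)
  then have "?K \<noteq> {}" by blast
  moreover have "compact ?K"
    using closed_subspace[OF S(1)] by (simp add: closed_Int_compact)
  moreover have "continuous_on ?K (\<lambda>x. x \<bullet> f x)"
    using f by (intro continuous_on_inner continuous_on_id linear_continuous_on)
      (simp add: linear_conv_bounded_linear)
  ultimately obtain e where e: "e \<in> ?K" and max: "\<And>y. y \<in> ?K \<Longrightarrow> y \<bullet> f y \<le> e \<bullet> f e"
    using continuous_attains_sup[of ?K "\<lambda>x. x \<bullet> f x"] by blast
  define \<mu> where "\<mu> = e \<bullet> f e"
  have eS: "e \<in> S" and ne: "norm e = 1" using e by auto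
  then have ee: "e \<bullet> e = 1" by (simp add: norm_eq_1)
  have bound: "y \<bullet> f y \<le> \<mu> * (y \<bullet> y)" if "y \<in> S" for y
  proof (cases "y = 0")
    case False
    have "y /\<^sub>R norm y \<in> ?K" using False that S by (simp add: subspace_scale)
    from max[OF this] have "(y \<bullet> f y) / (norm y * norm y) \<le> \<mu>"
      by (simp add: linear_scale[OF f] \<mu>_def divide_inverse mult_ac)
    then show ?thesis using False by (simp add: divide_simps dot_square_norm power2_eq_square)
  qed (use linear_0[OF f] in simp)
  have orth: "y \<bullet> f e = 0" if y: "y \<in> S" "y \<bullet> e = 0" for y
  proof -
    have main: "2 * t * (y \<bullet> f e) \<le> t\<^sup>2 * (\<mu> * (y \<bullet> y) - y \<bullet> f y)" for t
    proof -
      have mem: "e + t *\<^sub>R y \<in> S" using eS y S by (simp add: subspace_add subspace_scale)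
      have "f (e + t *\<^sub>R y) = f e + t *\<^sub>R f y" by (simp add: linear_add[OF f] linear_scale[OF f])
      moreover have "e \<bullet> f y = y \<bullet> f e" using sa[of e y] by (simp add: inner_commute)
      ultimately have "(e + t *\<^sub>R y) \<bullet> f (e + t *\<^sub>R y) = \<mu> + 2 * t * (y \<bullet> f e) + t\<^sup>2 * (y \<bullet> f y)"
        by (simp add: inner_add_left inner_add_right \<mu>_def power2_eq_square algebra_simps)
      moreover have "(e + t *\<^sub>R y) \<bullet> (e + t *\<^sub>R y) = 1 + t\<^sup>2 * (y \<bullet> y)"
        using y ee by (simp add: inner_add_left inner_add_right inner_commute power2_eq_square)
      ultimately show ?thesis using bound[OF mem] by (simp add: algebra_simps)
    qed
    \<comment> \<open>For \<open>t\<close> near \<open>0\<close> the left side of \<open>main\<close> dominates. The choice \<open>t = r / q\<close> balances the two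
      sides; adding \<open>1\<close> to \<open>q\<close> keeps it positive.\<close>
    define r where "r = y \<bullet> f e"
    define q where "q = \<bar>\<mu> * (y \<bullet> y) - y \<bullet> f y\<bar> + 1"
    have "q > 0" by (simp add: q_def)
    have "2 * (r / q) * r \<le> (r / q)\<^sup>2 * (\<mu> * (y \<bullet> y) - y \<bullet> f y)" using main r_def by blast
    also have "\<dots> \<le> (r / q)\<^sup>2 * q" by (intro mult_left_mono) (auto simp: q_def)
    also have "\<dots> = r\<^sup>2 / q" using \<open>q > 0\<close> by (simp add: power2_eq_square divide_simps)
    finally have "r\<^sup>2 / q \<le> 0" by (simp add: power2_eq_square)
    then have "r\<^sup>2 \<le> 0" using \<open>q > 0\<close> by (simp add: divide_le_0_iff)
    then show ?thesis by (simp add: r_def)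
  qed
  define y where "y = f e - \<mu> *\<^sub>R e"
  have "y \<in> S" using eS S by (auto simp: y_def intro!: subspace_diff subspace_scale)
  moreover have ye: "y \<bullet> e = 0"
    using ee by (simp add: y_def inner_diff_left \<mu>_def inner_commute[of "f e"])
  ultimately have "y \<bullet> f e = 0" by (rule orth)
  then have "y \<bullet> y = 0" using ye by (simp add: y_def inner_diff_right)
  then have "f e = \<mu> *\<^sub>R e" by (simp add: y_def)
  then show thesis using that eS ne by blast
qed

text \<open>The orthogonal complement of an eigenvector is again invariant, so induct on the dimension.\<close>

lemma selfadjoint_eigenbasis_subspace:
  fixes f :: "'a::euclidean_space \<Rightarrow> 'a"
  assumes f: "linear f" and sa: "\<And>x y. f x \<bullet> y = x \<bullet> f y"
    and S: "subspace S" "f ` S \<subseteq> S"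
  shows "\<exists>B\<subseteq>S. finite B \<and> pairwise orthogonal B \<and>
           (\<forall>b\<in>B. norm b = 1 \<and> (\<exists>c. f b = c *\<^sub>R b)) \<and> span B = S"
  using S
proof (induction "dim S" arbitrary: S rule: less_induct)
  case less
  show ?case
  proof (cases "S = {0}")
    case True
    then show ?thesis by (intro exI[of _ "{}"]) auto
  next
    case False
    then obtain e c where e: "e \<in> S" "norm e = 1" "f e = c *\<^sub>R e"
      using selfadjoint_eigenvector[OF f sa less.prems] by metis
    then have ee: "e \<bullet> e = 1" by (simp add: norm_eq_1)
    define T where "T = {y \<in> S. e \<bullet> y = 0}"
    have T: "subspace T"
      using less.prems(1) by (auto simp: T_def subspace_def inner_add_right)
    have inv: "f ` T \<subseteq> T"
    proof -
      have "e \<bullet> f y = 0" if "e \<bullet> y = 0" for y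
        using sa[of e y] e(3) that by simp
      then show ?thesis using less.prems(2) by (auto simp: T_def)
    qed
    have "e \<notin> T" using ee by (simp add: T_def)
    then have "T \<subset> S" using e(1) T_def by blast
    then have "dim T < dim S"
      using dim_psubset[of T S] T less.prems(1) by (metis span_eq_iff)
    from less.hyps[OF this T inv] obtain B where
      B: "B \<subseteq> T" "finite B" "pairwise orthogonal B"
        "\<forall>b\<in>B. norm b = 1 \<and> (\<exists>c. f b = c *\<^sub>R b)" "span B = T" by blast
    have "span (insert e B) = S"
    proof
      show "span (insert e B) \<subseteq> S"
        using e B \<open>T \<subset> S\<close> less.prems(1) by (intro span_minimal) auto
      show "S \<subseteq> span (insert e B)"
      proof
        fix x assume x: "x \<in> S"
        have "x - (e \<bullet> x) *\<^sub>R e \<in> T"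
          using x e(1) ee less.prems(1)
          by (simp add: T_def subspace_diff subspace_scale inner_diff_right)
        then show "x \<in> span (insert e B)" using B(5) by (auto simp: span_breakdown_eq)
      qed
    qed
    moreover have "pairwise orthogonal (insert e B)"
      using B by (auto simp: pairwise_insert T_def orthogonal_def inner_commute)
    ultimately show ?thesis
      using B e \<open>T \<subset> S\<close> by (intro exI[of _ "insert e B"]) auto
  qed
qed

lemma symmetric_matrix_eigenbasis:
  fixes T :: "real^'n^'n"
  assumes "transpose T = T"
  obtains B where "orthonormal_basis B" "\<And>b. b \<in> B \<Longrightarrow> \<exists>c. T *v b = c *\<^sub>R b"
proof -
  have "(T *v x) \<bullet> y = x \<bullet> (T *v y)" for x y
    using dot_lmul_matrix[of x T y] transpose_matrix_vector[of T x] assms by simp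
  from selfadjoint_eigenbasis_subspace[OF matrix_vector_mul_linear this subspace_UNIV]
  show thesis using that by (auto simp: orthonormal_basis_def)
qed

section \<open>Rank-one matrices\<close>

definition outer :: "real^'n \<Rightarrow> real^'p \<Rightarrow> real^'p^'n" where
  "outer u w = (\<chi> i. u $ i *\<^sub>R w)"

lemma vector_outer: "x v* outer u w = (x \<bullet> u) *\<^sub>R w"
  by (simp add: outer_def vec_eq_iff vector_matrix_mult_def inner_vec_def sum_distrib_left mult_ac)

lemma outer_vector: "outer u w *v y = (w \<bullet> y) *\<^sub>R u"
  by (simp add: outer_def vec_eq_iff matrix_vector_mult_def inner_vec_def sum_distrib_left mult_ac)

lemma inner_outer: "outer u w \<bullet> Y = (u v* Y) \<bullet> w"
proof -
  have "outer u w \<bullet> Y = (\<Sum>i\<in>UNIV. \<Sum>j\<in>UNIV. u $ i * Y $ i $ j * w $ j)"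
    by (simp add: outer_def inner_vec_def sum_distrib_left mult_ac)
  also have "\<dots> = (u v* Y) \<bullet> w"
    by (subst sum.swap) (simp add: vector_matrix_mult_def inner_vec_def sum_distrib_right)
  finally show ?thesis .
qed

lemma transpose_outer: "transpose (outer u w) = outer w u"
  by (simp add: outer_def transpose_def vec_eq_iff)

lemma matrix_eq_by_rows: "(\<And>x. x v* A = x v* B) \<Longrightarrow> A = (B :: real^'p^'n)"
  by (metis matrix_eq transpose_matrix_vector transpose_transpose)

lemma outer_mult: "outer u w ** M = outer u (w v* (M :: real^'q^'p))"
  by (rule matrix_eq_by_rows)
     (simp add: vector_outer flip: vector_matrix_mul_assoc scaleR_vector_matrix_assoc)

lemma linear_vector_matrix: "linear (\<lambda>X :: real^'p^'n. x v* X)"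
  by (rule linearI) (simp_all add: vector_matrix_mult_add_rdistrib vector_scaleR_matrix_ac)

lemma linear_vector_matrix_left: "linear (\<lambda>x. x v* (X :: real^'p^'n))"
  by (rule linearI) (simp_all add: vector_matrix_left_distrib scaleR_vector_matrix_assoc)

text \<open>The identity is \<open>\<Sum>b\<in>B. b b\<^sup>T\<close>; multiply it by \<open>X\<close> from the right.\<close>

lemma matrix_row_expansion:
  fixes X :: "real^'p^'n"
  assumes "orthonormal_basis B"
  shows "X = (\<Sum>b\<in>B. outer b (b v* X))"
proof (rule matrix_eq_by_rows)
  fix x :: "real^'n"
  have "x v* X = (\<Sum>b\<in>B. (b \<bullet> x) *\<^sub>R b) v* X"
    using orthonormal_basis_expansion[OF assms] by simp
  also have "\<dots> = x v* (\<Sum>b\<in>B. outer b (b v* X))"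
    by (simp add: linear_sum[OF linear_vector_matrix] linear_sum[OF linear_vector_matrix_left]
        vector_outer scaleR_vector_matrix_assoc inner_commute)
  finally show "x v* X = x v* (\<Sum>b\<in>B. outer b (b v* X))" .
qed

text \<open>
  The Frobenius inner product may be computed in the rows with respect to any orthonormal basis;
  this is how singular values enter inner products.
\<close>

lemma inner_matrix_eq_sum:
  fixes X Y :: "real^'p^'n"
  assumes "orthonormal_basis B"
  shows "X \<bullet> Y = (\<Sum>b\<in>B. (b v* X) \<bullet> (b v* Y))"
proof -
  have "X \<bullet> Y = (\<Sum>b\<in>B. outer b (b v* X)) \<bullet> Y"
    using matrix_row_expansion[OF assms, of X] by simp
  then show ?thesis by (simp add: inner_sum_left inner_outer inner_commute[of "_ v* X"])
qed

lemma matrix_eq_on_basis: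
  fixes X Y :: "real^'p^'n"
  assumes "orthonormal_basis B" "\<And>b. b \<in> B \<Longrightarrow> b v* X = b v* Y"
  shows "X = Y"
proof -
  have "(\<Sum>b\<in>B. outer b (b v* X)) = (\<Sum>b\<in>B. outer b (b v* Y))" using assms(2) by simp
  then show ?thesis using matrix_row_expansion[OF assms(1)] by metis
qed

lemma inner_outer_outer: "outer a b \<bullet> outer c d = (a \<bullet> c) * (b \<bullet> d)"
  by (simp add: inner_outer vector_outer inner_commute)

lemma linear_transpose: "linear (transpose :: real^'p^'n \<Rightarrow> _)"
  by (rule linearI) (simp_all add: transpose_def vec_eq_iff)

lemma linear_matrix_mult_left: "linear (\<lambda>D :: real^'m^'n. D ** (V :: real^'p^'m))"
  by (rule linearI; rule matrix_eq_by_rows)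
    (simp_all add: vector_matrix_mult_add_rdistrib vector_matrix_left_distrib
      vector_scaleR_matrix_ac scaleR_vector_matrix_assoc flip: vector_matrix_mul_assoc)

text \<open>
  A linear condition on \<open>D ** V\<close> is a linear condition on \<open>D\<close>. This turns the constraints on the
  perturbation of \<open>X\<close> into constraints on the perturbation of its positive factor.
\<close>

lemma inner_matrix_mult:
  fixes D :: "real^'n^'n" and V C :: "real^'p^'n"
  shows "C \<bullet> (D ** V) = (C ** transpose V) \<bullet> D"
proof -
  obtain B :: "(real^'n) set" where B: "orthonormal_basis B"
    using orthonormal_basis_exists by blast
  have "C \<bullet> (D ** V) = (\<Sum>b\<in>B. (b v* D v* V) \<bullet> (b v* C))"
    by (simp add: inner_matrix_eq_sum[OF B] vector_matrix_mul_assoc inner_commute)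
  also have "\<dots> = (\<Sum>b\<in>B. (b v* D) \<bullet> (b v* (C ** transpose V)))"
    by (subst dot_lmul_matrix) (simp flip: vector_matrix_mul_assoc)
  also have "\<dots> = (C ** transpose V) \<bullet> D"
    by (simp add: inner_matrix_eq_sum[OF B] inner_commute)
  finally show ?thesis .
qed

lemma inner_trace:
  fixes T :: "real^'n^'n"
  assumes "orthonormal_basis B"
  shows "mat 1 \<bullet> T = (\<Sum>b\<in>B. (b v* T) \<bullet> b)"
  by (simp add: inner_matrix_eq_sum[OF assms] inner_commute)

section \<open>Singular bases\<close>

text \<open>
  An orthonormal basis of eigenvectors of \<open>X X\<^sup>T\<close>, that is, of left singular vectors. The
  singular value belonging to \<open>b\<close> is \<open>norm (b v* X)\<close>, so it needs no separate name.
\<close>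

definition singular_basis :: "real^'p^'n \<Rightarrow> (real^'n) set \<Rightarrow> bool" where
  "singular_basis X B \<longleftrightarrow> orthonormal_basis B \<and>
     (\<forall>b\<in>B. X *v (b v* X) = (norm (b v* X))\<^sup>2 *\<^sub>R b)"

lemma singular_basis_exists:
  fixes X :: "real^'p^'n"
  obtains B where "singular_basis X B"
proof -
  let ?T = "X ** transpose X"
  have T: "?T *v x = X *v (x v* X)" for x
    by (simp flip: matrix_vector_mul_assoc)
  have "transpose ?T = ?T" by (simp add: matrix_transpose_mul)
  then obtain B where B: "orthonormal_basis B" and ev: "\<And>b. b \<in> B \<Longrightarrow> \<exists>c. ?T *v b = c *\<^sub>R b"
    using symmetric_matrix_eigenbasis by blast
  have "X *v (b v* X) = (norm (b v* X))\<^sup>2 *\<^sub>R b" if b: "b \<in> B" for b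
  proof -
    obtain c where c: "X *v (b v* X) = c *\<^sub>R b" using ev[OF b] T by metis
    have "(norm (b v* X))\<^sup>2 = b \<bullet> (X *v (b v* X))"
      by (simp add: dot_lmul_matrix flip: dot_square_norm)
    also have "\<dots> = c" using c orthonormal_basis_inner[OF B b b] by simp
    finally show ?thesis using c by simp
  qed
  then show thesis using that B by (auto simp: singular_basis_def)
qed

lemma singular_basis_onb: "singular_basis X B \<Longrightarrow> orthonormal_basis B"
  by (simp add: singular_basis_def)

lemma singular_basis_finite: "singular_basis X B \<Longrightarrow> finite B"
  by (simp add: singular_basis_onb orthonormal_basis_finite)

lemma singular_basis_rows_inner:
  assumes "singular_basis X B" "b \<in> B"
  shows "(x v* X) \<bullet> (b v* X) = (norm (b v* X))\<^sup>2 * (x \<bullet> b)"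
  using assms by (simp add: singular_basis_def dot_lmul_matrix)

lemma singular_basis_rows_orthogonal:
  assumes "singular_basis X B" "b \<in> B" "c \<in> B" "b \<noteq> c"
  shows "(b v* X) \<bullet> (c v* X) = 0"
  using singular_basis_rows_inner[OF assms(1,3)] assms
  by (simp add: orthonormal_basis_inner[OF singular_basis_onb])

lemma mem_singular_space_iff:
  assumes B: "singular_basis X B" and "s \<ge> 0"
  shows "x \<in> singular_space X s \<longleftrightarrow> (\<forall>b\<in>B. norm (b v* X) = s \<or> b \<bullet> x = 0)"
proof -
  have "x \<in> singular_space X s \<longleftrightarrow> X *v (x v* X) = s\<^sup>2 *\<^sub>R x"
    by (simp add: singular_space_def flip: matrix_vector_mul_assoc)
  also have "\<dots> \<longleftrightarrow> (\<forall>b\<in>B. b \<bullet> (X *v (x v* X)) = b \<bullet> (s\<^sup>2 *\<^sub>R x))"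
    using orthonormal_basis_eqI[OF singular_basis_onb[OF B]] by metis
  also have "\<dots> \<longleftrightarrow> (\<forall>b\<in>B. (norm (b v* X))\<^sup>2 * (b \<bullet> x) = s\<^sup>2 * (b \<bullet> x))"
    using singular_basis_rows_inner[OF B, of _ x]
    by (simp add: inner_commute flip: dot_lmul_matrix)
  also have "\<dots> \<longleftrightarrow> (\<forall>b\<in>B. norm (b v* X) = s \<or> b \<bullet> x = 0)"
    using \<open>s \<ge> 0\<close> by (auto simp: power2_eq_iff_nonneg)
  finally show ?thesis .
qed

text \<open>
  The basis vectors with singular value \<open>s\<close> span the eigenspace, so the multiplicities are
  counted by the basis. Hence sums over singular values with multiplicity become sums over the basis.
\<close>

lemma dim_singular_space:
  assumes B: "singular_basis X B" and s: "s \<ge> 0"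
  shows "dim (singular_space X s) = card {b\<in>B. norm (b v* X) = s}"
proof -
  let ?B = "{b\<in>B. norm (b v* X) = s}"
  note onb = singular_basis_onb[OF B]
  have "x \<in> span ?B" if "x \<in> singular_space X s" for x
  proof -
    have "(\<Sum>b\<in>B. (b \<bullet> x) *\<^sub>R b) \<in> span ?B"
      using that unfolding mem_singular_space_iff[OF B s]
      by (intro span_sum) (metis (mono_tags, lifting) mem_Collect_eq scale_zero_left span_base span_scale span_zero)
    then show ?thesis by (simp add: orthonormal_basis_expansion[OF onb])
  qed
  moreover have "?B \<subseteq> singular_space X s"
    using orthonormal_basis_inner[OF onb]
    by (clarsimp simp: mem_singular_space_iff[OF B])
  moreover have "independent ?B"
    using onb by (intro pairwise_orthogonal_independent)
      (auto simp: orthonormal_basis_def pairwise_def)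
  ultimately show ?thesis by (intro dim_unique[of ?B]) auto
qed

lemma singular_values_eq:
  assumes B: "singular_basis X B"
  shows "singular_values X = (\<lambda>b. norm (b v* X)) ` B"
proof (intro equalityI subsetI)
  fix s assume "s \<in> singular_values X"
  then obtain u where s: "s \<ge> 0" and u: "u \<in> singular_space X s" "u \<noteq> 0"
    by (auto simp: singular_values_def)
  obtain b where "b \<in> B" "b \<bullet> u \<noteq> 0"
    using orthonormal_basis_eqI[OF singular_basis_onb[OF B], of u 0] u(2) by auto
  then show "s \<in> (\<lambda>b. norm (b v* X)) ` B"
    using u(1) by (auto simp: mem_singular_space_iff[OF B s])
next
  fix s assume "s \<in> (\<lambda>b. norm (b v* X)) ` B"
  then obtain b where b: "b \<in> B" "s = norm (b v* X)" by blast
  note onb = singular_basis_onb[OF B]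
  have "b \<noteq> 0" using orthonormal_basis_inner[OF onb b(1) b(1)] by auto
  moreover have "b \<in> singular_space X s"
    unfolding b(2) mem_singular_space_iff[OF B norm_ge_zero]
    using orthonormal_basis_inner[OF onb _ b(1)] by auto
  ultimately show "s \<in> singular_values X" using b by (auto simp: singular_values_def)
qed

lemma spectral_norm_le_iff:
  assumes "singular_basis X B"
  shows "spectral_norm X \<le> c \<longleftrightarrow> (\<forall>b\<in>B. norm (b v* X) \<le> c)"
  using singular_basis_finite[OF assms] orthonormal_basis_nonempty[OF singular_basis_onb[OF assms]]
  by (simp add: spectral_norm_def singular_values_eq[OF assms])

lemma nuclear_norm_eq:
  assumes "singular_basis X B"
  shows "nuclear_norm X = (\<Sum>b\<in>B. norm (b v* X))"
proof -
  let ?f = "\<lambda>b. norm (b v* X)"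
  have "(\<Sum>b\<in>B. ?f b) = (\<Sum>s\<in>?f ` B. \<Sum>b\<in>{b\<in>B. ?f b = s}. ?f b)"
    by (rule sum.image_gen[OF singular_basis_finite[OF assms]])
  also have "\<dots> = (\<Sum>s\<in>?f ` B. real (card {b\<in>B. ?f b = s}) * s)"
    by (rule sum.cong) auto
  also have "\<dots> = nuclear_norm X"
    unfolding nuclear_norm_def singular_values_eq[OF assms]
    by (rule sum.cong) (auto simp: dim_singular_space[OF assms])
  finally show ?thesis by simp
qed

text \<open>
  The nonzero vectors among the \<open>b v* X\<close> are orthogonal and span the row space.
\<close>

lemma rank_eq_card_nonzero:
  fixes X :: "real^'p^'n"
  assumes B: "singular_basis X B"
  shows "rank X = card {b\<in>B. b v* X \<noteq> 0}"
proof -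
  let ?B = "{b\<in>B. b v* X \<noteq> 0}" and ?f = "\<lambda>b. b v* X"
  note orth = singular_basis_rows_orthogonal[OF B]
  have "inj_on ?f ?B"
    using orth by (intro inj_onI) (metis (mono_tags, lifting) inner_eq_zero_iff mem_Collect_eq)
  have "rank X = rank (transpose X)" by (simp add: rank_transpose)
  also have "\<dots> = dim (range ?f)" by (simp add: rank_dim_range)
  also have "\<dots> = card (?f ` ?B)"
  proof (rule dim_unique)
    show "?f ` ?B \<subseteq> range ?f" by auto
    show "range ?f \<subseteq> span (?f ` ?B)"
    proof clarify
      fix x :: "real^'n"
      have "x v* X = (\<Sum>b\<in>B. (b \<bullet> x) *\<^sub>R (b v* X))"
        using orthonormal_basis_expansion[OF singular_basis_onb[OF B], of x]
        by (metis (no_types, lifting) linear_sum linear_vector_matrix_left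
            scaleR_vector_matrix_assoc sum.cong)
      also have "\<dots> \<in> span (?f ` ?B)"
        by (intro span_sum) (metis (mono_tags, lifting) image_eqI mem_Collect_eq
            scaleR_zero_right span_base span_scale span_zero)
      finally show "x v* X \<in> span (?f ` ?B)" .
    qed
    show "independent (?f ` ?B)"
      using orth by (intro pairwise_orthogonal_independent)
        (fastforce simp: pairwise_def orthogonal_def)+
  qed simp
  also have "\<dots> = card ?B" using \<open>inj_on ?f ?B\<close> by (rule card_image)
  finally show ?thesis .
qed

section \<open>Contractions\<close>

text \<open>
  The bilinear form of the condition presents it as an intersection of halfspaces
  \<open>outer x y \<bullet> X \<le> norm x * norm y\<close>, from which convexity and closedness are immediate.
\<close>

definition contraction :: "real^'p^'n \<Rightarrow> bool" where
  "contraction X \<longleftrightarrow> (\<forall>x y. x \<bullet> (X *v y) \<le> norm x * norm y)"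

lemma contraction_row:
  assumes "contraction X"
  shows "norm (x v* X) \<le> norm x"
proof -
  have "(x v* X) \<bullet> (x v* X) \<le> norm x * norm (x v* X)"
    using assms by (simp add: contraction_def dot_lmul_matrix)
  then have "norm (x v* X) * norm (x v* X) \<le> norm x * norm (x v* X)"
    by (simp add: dot_square_norm power2_eq_square)
  then show ?thesis
    by (cases "x v* X = 0") (auto simp: mult_le_cancel_right)
qed

lemma contractionI:
  assumes "\<And>x. norm (x v* X) \<le> norm x"
  shows "contraction X"
  unfolding contraction_def
proof (intro allI)
  fix x y
  have "x \<bullet> (X *v y) = (x v* X) \<bullet> y" by (simp add: dot_lmul_matrix)
  also have "\<dots> \<le> norm (x v* X) * norm y" by (rule norm_cauchy_schwarz)
  also have "\<dots> \<le> norm x * norm y" using assms by (simp add: mult_right_mono)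
  finally show "x \<bullet> (X *v y) \<le> norm x * norm y" .
qed

lemma contraction_mult:
  assumes "contraction (X :: real^'p^'n)" "contraction (Y :: real^'q^'p)"
  shows "contraction (X ** Y)"
  by (rule contractionI)
     (metis assms contraction_row order_trans vector_matrix_mul_assoc)

lemma contraction_iff_singular:
  fixes X :: "real^'p^'n"
  assumes B: "singular_basis X B"
  shows "contraction X \<longleftrightarrow> (\<forall>b\<in>B. norm (b v* X) \<le> 1)"
proof
  assume "contraction X"
  then show "\<forall>b\<in>B. norm (b v* X) \<le> 1"
    using contraction_row[of X] singular_basis_onb[OF B] by (metis orthonormal_basis_def)
next
  assume le: "\<forall>b\<in>B. norm (b v* X) \<le> 1"
  note onb = singular_basis_onb[OF B]
  show "contraction X"
  proof (rule contractionI)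
    fix x :: "real^'n"
    have row: "b \<bullet> (X *v (x v* X)) = (norm (b v* X))\<^sup>2 * (b \<bullet> x)" if "b \<in> B" for b
      using singular_basis_rows_inner[OF B that, of x]
      by (simp add: inner_commute flip: dot_lmul_matrix)
    have "(norm (x v* X))\<^sup>2 = x \<bullet> (X *v (x v* X))"
      by (simp add: dot_lmul_matrix flip: dot_square_norm)
    also have "\<dots> = (\<Sum>b\<in>B. (norm (b v* X))\<^sup>2 * (b \<bullet> x)\<^sup>2)"
      unfolding parseval[OF onb, of x]
      by (rule sum.cong) (auto simp: row power2_eq_square)
    also have "\<dots> \<le> (\<Sum>b\<in>B. (b \<bullet> x)\<^sup>2)"
      using le by (intro sum_mono mult_left_le_one_le) (auto simp: power_le_one)
    also have "\<dots> = (norm x)\<^sup>2"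
      using parseval[OF onb, of x x] by (simp add: power2_eq_square dot_square_norm)
    finally show "norm (x v* X) \<le> norm x" by (rule power2_le_imp_le) simp
  qed
qed

lemma spectral_norm_le_1_iff: "spectral_norm X \<le> 1 \<longleftrightarrow> contraction X"
  by (metis singular_basis_exists spectral_norm_le_iff contraction_iff_singular)

section \<open>Polar decomposition\<close>

text \<open>
  The partial isometry sending the right singular vector \<open>sgn (b v* X)\<close> to \<open>b\<close>. Since
  \<open>sgn 0 = 0\<close>, it vanishes on the kernel of \<open>X\<close>.
\<close>

definition polar_factor :: "real^'p^'n \<Rightarrow> (real^'n) set \<Rightarrow> real^'p^'n" where
  "polar_factor X B = (\<Sum>b\<in>B. outer b (sgn (b v* X)))"

lemma polar_factor_row:
  assumes B: "orthonormal_basis B" and b: "b \<in> B"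
  shows "b v* polar_factor X B = sgn (b v* X)"
proof -
  have "b v* polar_factor X B = (\<Sum>c\<in>B. if b = c then sgn (c v* X) else 0)"
    unfolding polar_factor_def linear_sum[OF linear_vector_matrix] vector_outer
    by (rule sum.cong) (simp_all add: orthonormal_basis_inner[OF B b])
  then show ?thesis using b orthonormal_basis_finite[OF B] by simp
qed

lemma sgn_inner_self: "sgn x \<bullet> x = norm (x :: 'a::real_inner)"
  by (cases "x = 0") (simp_all add: sgn_div_norm dot_square_norm power2_eq_square)

lemma sgn_inner_sgn: "sgn x \<bullet> sgn x = (if x = 0 then 0 else (1 :: real))" for x :: "'a::real_inner"
  by (simp add: norm_sgn dot_square_norm)

lemma polar_factor_vector:
  assumes B: "singular_basis X B" and b: "b \<in> B"
  shows "polar_factor X B *v sgn (b v* X) = (if b v* X = 0 then 0 else b)"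
proof -
  have "c \<bullet> (polar_factor X B *v sgn (b v* X)) = c \<bullet> (if b v* X = 0 then 0 else b)"
    if c: "c \<in> B" for c
  proof -
    have "c \<bullet> (polar_factor X B *v sgn (b v* X)) = sgn (c v* X) \<bullet> sgn (b v* X)"
      by (simp add: polar_factor_row[OF singular_basis_onb[OF B] c] flip: dot_lmul_matrix)
    also have "\<dots> = (if c = b then if b v* X = 0 then 0 else 1 else 0)"
      using singular_basis_rows_orthogonal[OF B c b] by (simp add: sgn_inner_sgn) (simp add: sgn_div_norm)
    also have "\<dots> = c \<bullet> (if b v* X = 0 then 0 else b)"
      using orthonormal_basis_inner[OF singular_basis_onb[OF B] c b] by auto
    finally show ?thesis .
  qed
  then show ?thesis by (rule orthonormal_basis_eqI[OF singular_basis_onb[OF B]])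
qed

text \<open>
  The basis \<open>B\<close> is also singular for the polar factor, with singular values \<open>0\<close> and \<open>1\<close>.
\<close>

lemma contraction_polar_factor:
  assumes B: "singular_basis X B"
  shows "contraction (polar_factor X B)"
proof -
  have "singular_basis (polar_factor X B) B"
    unfolding singular_basis_def
    using B by (auto simp: polar_factor_row singular_basis_onb polar_factor_vector norm_sgn)
  then show ?thesis
    by (simp add: contraction_iff_singular polar_factor_row[OF singular_basis_onb[OF B]] norm_sgn)
qed

text \<open>The square root of \<open>X X\<^sup>T\<close>.\<close>

definition positive_factor :: "real^'p^'n \<Rightarrow> (real^'n) set \<Rightarrow> real^'n^'n" where
  "positive_factor X B = (\<Sum>b\<in>B. norm (b v* X) *\<^sub>R outer b b)"

lemma positive_factor_row:
  assumes B: "orthonormal_basis B" and b: "b \<in> B"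
  shows "b v* positive_factor X B = norm (b v* X) *\<^sub>R b"
proof -
  have "b v* positive_factor X B = (\<Sum>c\<in>B. if b = c then norm (c v* X) *\<^sub>R c else 0)"
    unfolding positive_factor_def linear_sum[OF linear_vector_matrix] vector_scaleR_matrix_ac vector_outer
    by (rule sum.cong) (simp_all add: orthonormal_basis_inner[OF B b])
  then show ?thesis using b orthonormal_basis_finite[OF B] by simp
qed

lemma transpose_positive_factor: "transpose (positive_factor X B) = positive_factor X B"
  by (simp add: positive_factor_def linear_sum[OF linear_transpose] linear_scale[OF linear_transpose]
      transpose_outer)

lemma polar_decomposition:
  assumes "orthonormal_basis B"
  shows "positive_factor X B ** polar_factor X B = (X :: real^'p^'n)"
proof (rule matrix_eq_on_basis[OF assms])
  have "norm x *\<^sub>R sgn x = x" for x :: "real^'p"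
    by (cases "x = 0") (simp_all add: sgn_div_norm)
  then show "b v* (positive_factor X B ** polar_factor X B) = b v* X" if "b \<in> B" for b
    using that
    by (simp add: positive_factor_row[OF assms] polar_factor_row[OF assms]
        scaleR_vector_matrix_assoc flip: vector_matrix_mul_assoc)
qed

lemma positive_factor_quadratic:
  assumes B: "orthonormal_basis B"
  shows "x \<bullet> (positive_factor X B *v x) = (\<Sum>b\<in>B. norm (b v* X) * (b \<bullet> x)\<^sup>2)"
  unfolding parseval[OF B, of x]
  by (rule sum.cong) (simp_all add: positive_factor_row[OF B] power2_eq_square flip: dot_lmul_matrix)

section \<open>The nuclear norm as a dual norm\<close>

lemma inner_contraction_le:
  assumes B: "orthonormal_basis B" and Y: "contraction Y"
  shows "X \<bullet> Y \<le> (\<Sum>b\<in>B. norm (b v* X))"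
proof -
  have "(b v* X) \<bullet> (b v* Y) \<le> norm (b v* X)" if "b \<in> B" for b
  proof -
    have "norm (b v* Y) \<le> 1"
      using contraction_row[OF Y, of b] B that by (simp add: orthonormal_basis_def)
    then have "norm (b v* X) * norm (b v* Y) \<le> norm (b v* X)"
      by (simp add: mult_left_le)
    then show ?thesis using norm_cauchy_schwarz order_trans by blast
  qed
  then show ?thesis by (simp add: inner_matrix_eq_sum[OF B] sum_mono)
qed

text \<open>
  The supremum of \<open>X \<bullet> Y\<close> over contractions \<open>Y\<close> is attained at the polar factor of \<open>X\<close>.
\<close>

lemma nuclear_norm_le_iff: "nuclear_norm X \<le> c \<longleftrightarrow> (\<forall>Y. contraction Y \<longrightarrow> X \<bullet> Y \<le> c)"
proof -
  obtain B where B: "singular_basis X B" by (rule singular_basis_exists)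
  note onb = singular_basis_onb[OF B]
  have "X \<bullet> polar_factor X B = nuclear_norm X"
    unfolding inner_matrix_eq_sum[OF onb] nuclear_norm_eq[OF B]
    by (rule sum.cong) (simp_all add: polar_factor_row[OF onb] inner_commute[of _ "sgn _"] sgn_inner_self)
  then show ?thesis
    using contraction_polar_factor[OF B] inner_contraction_le[OF onb]
    by (metis nuclear_norm_eq[OF B] order_trans)
qed

section \<open>The relaxed feasible set\<close>

definition nuclear_spectral_ball :: "nat \<Rightarrow> (real^'p^'n) set" where
  "nuclear_spectral_ball k = {X. nuclear_norm X \<le> real k \<and> spectral_norm X \<le> 1}"

lemma mem_nuclear_spectral_ball:
  "X \<in> nuclear_spectral_ball k \<longleftrightarrow>
     contraction X \<and> (\<forall>Y. contraction Y \<longrightarrow> X \<bullet> Y \<le> real k)"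
  by (auto simp: nuclear_spectral_ball_def nuclear_norm_le_iff spectral_norm_le_1_iff)

lemma nuclear_spectral_ball_halfspaces:
  "nuclear_spectral_ball k =
     (\<Inter>(x, y). {X. outer x y \<bullet> X \<le> norm x * norm y}) \<inter>
     (\<Inter>Y\<in>Collect contraction. {X. Y \<bullet> X \<le> real k})"
proof -
  have "X \<in> nuclear_spectral_ball k \<longleftrightarrow>
      (\<forall>x y. outer x y \<bullet> X \<le> norm x * norm y) \<and> (\<forall>Y. contraction Y \<longrightarrow> Y \<bullet> X \<le> real k)"
    for X :: "real^'p^'n"
    by (simp add: mem_nuclear_spectral_ball contraction_def[of X] inner_outer dot_lmul_matrix
        inner_commute[of X])
  then show ?thesis by auto
qed

lemma convex_nuclear_spectral_ball: "convex (nuclear_spectral_ball k)"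
  unfolding nuclear_spectral_ball_halfspaces
  by (intro convex_Int convex_INT) (auto simp: convex_halfspace_le)

text \<open>
  For boundedness, note that \<open>X\<close> is itself a contraction: testing the dual condition with
  \<open>Y = X\<close> bounds its Frobenius norm by \<open>sqrt k\<close>.
\<close>

lemma compact_nuclear_spectral_ball: "compact (nuclear_spectral_ball k)"
proof (rule compact_eq_bounded_closed[THEN iffD2, OF conjI])
  show "closed (nuclear_spectral_ball k)"
    unfolding nuclear_spectral_ball_halfspaces
    by (intro closed_Int closed_INT) (auto simp: closed_halfspace_le)
  show "bounded (nuclear_spectral_ball k)"
  proof (rule boundedI)
    fix X :: "real^'p^'n" assume "X \<in> nuclear_spectral_ball k"
    then have "(norm X)\<^sup>2 \<le> real k"
      by (simp add: mem_nuclear_spectral_ball flip: dot_square_norm)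
    then show "norm X \<le> sqrt (real k)" by (rule real_le_rsqrt)
  qed
qed

lemma zero_mem_nuclear_spectral_ball: "0 \<in> nuclear_spectral_ball k"
  by (simp add: mem_nuclear_spectral_ball contraction_def)

text \<open>There are \<open>rank X\<close> nonzero singular values, each at most \<open>1\<close>.\<close>

lemma rank_spectral_set_subset: "rank_spectral_set k \<subseteq> nuclear_spectral_ball k"
proof
  fix X :: "real^'p^'n" assume "X \<in> rank_spectral_set k"
  then have r: "rank X \<le> k" and n: "spectral_norm X \<le> 1" by (auto simp: rank_spectral_set_def)
  obtain B where B: "singular_basis X B" by (rule singular_basis_exists)
  have "nuclear_norm X = (\<Sum>b\<in>{b\<in>B. b v* X \<noteq> 0}. norm (b v* X))"
    unfolding nuclear_norm_eq[OF B]
    by (rule sum.mono_neutral_right) (auto simp: singular_basis_finite[OF B])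
  also have "\<dots> \<le> real (card {b\<in>B. b v* X \<noteq> 0}) * 1"
    using n by (intro sum_bounded_above) (auto simp: spectral_norm_le_iff[OF B])
  also have "\<dots> \<le> real k" using r by (simp add: rank_eq_card_nonzero[OF B])
  finally show "X \<in> nuclear_spectral_ball k" using n by (simp add: nuclear_spectral_ball_def)
qed

section \<open>Symmetric matrices supported on an orthonormal set\<close>

definition symmetric_span :: "(real^'n) set \<Rightarrow> (real^'n^'n) set" where
  "symmetric_span S = span {outer u w + outer w u | u w. u \<in> S \<and> w \<in> S}"

text \<open>
  Symmetry, the quadratic bound and invariance under multiplication are each preserved by linear
  combinations, so by this lemma they need to be checked on the generators only.
\<close>

lemma symmetric_span_subset:
  assumes "subspace P" "\<And>u w. u \<in> S \<Longrightarrow> w \<in> S \<Longrightarrow> outer u w + outer w u \<in> P"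
  shows "symmetric_span S \<subseteq> P"
  unfolding symmetric_span_def by (rule span_minimal) (use assms in auto)

lemma transpose_symmetric_span:
  assumes "D \<in> symmetric_span S"
  shows "transpose D = D"
proof -
  have "symmetric_span S \<subseteq> {D. transpose D = D}"
    by (rule symmetric_span_subset)
      (auto simp: subspace_def linear_0[OF linear_transpose] linear_add[OF linear_transpose]
        linear_scale[OF linear_transpose] transpose_outer add.commute)
  then show ?thesis using assms by blast
qed

text \<open>
  The quadratic form of \<open>D\<close> depends only on the projection of \<open>x\<close> to the span of \<open>S\<close>. This is why
  a small multiple of \<open>D\<close> can be absorbed by a positive gap of the eigenvalues on \<open>S\<close> alone.
\<close>

lemma symmetric_span_quadratic_bound:
  assumes "finite S" "D \<in> symmetric_span S"
  shows "\<exists>M. \<forall>x. \<bar>x \<bullet> (D *v x)\<bar> \<le> M * (\<Sum>b\<in>S. (b \<bullet> x)\<^sup>2)"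
proof -
  let ?q = "\<lambda>x. \<Sum>b\<in>S. (b \<bullet> x)\<^sup>2"
  let ?P = "{D. \<exists>M. \<forall>x. \<bar>x \<bullet> (D *v x)\<bar> \<le> M * ?q x}"
  have "symmetric_span S \<subseteq> ?P"
  proof (rule symmetric_span_subset)
    show "subspace ?P"
    proof (rule subspaceI)
      show "0 \<in> ?P" by (auto intro!: exI[of _ 0])
    next
      fix D E assume "D \<in> ?P" "E \<in> ?P"
      then obtain M N where "\<forall>x. \<bar>x \<bullet> (D *v x)\<bar> \<le> M * ?q x" "\<forall>x. \<bar>x \<bullet> (E *v x)\<bar> \<le> N * ?q x"
        by blast
      then have "\<bar>x \<bullet> ((D + E) *v x)\<bar> \<le> (M + N) * ?q x" for x
        using abs_triangle_ineq[of "x \<bullet> (D *v x)" "x \<bullet> (E *v x)"]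
        by (simp add: matrix_vector_mult_add_rdistrib inner_add_right distrib_right)
           (meson add_mono order_trans)
      then show "D + E \<in> ?P" by blast
    next
      fix c D assume "D \<in> ?P"
      then obtain M where M: "\<forall>x. \<bar>x \<bullet> (D *v x)\<bar> \<le> M * ?q x" by blast
      have "\<bar>x \<bullet> ((c *\<^sub>R D) *v x)\<bar> \<le> (\<bar>c\<bar> * M) * ?q x" for x
        using mult_left_mono[OF M[rule_format, of x], of "\<bar>c\<bar>"]
        by (simp add: scaleR_matrix_vector_assoc[symmetric] abs_mult mult.assoc)
      then show "c *\<^sub>R D \<in> ?P" by blast
    qed
  next
    fix u w assume uw: "u \<in> S" "w \<in> S"
    have "\<bar>x \<bullet> ((outer u w + outer w u) *v x)\<bar> \<le> 2 * ?q x" for x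
    proof -
      have mem: "(b \<bullet> x)\<^sup>2 \<le> ?q x" if "b \<in> S" for b
        using that assms(1) by (intro member_le_sum) auto
      have "x \<bullet> ((outer u w + outer w u) *v x) = 2 * ((u \<bullet> x) * (w \<bullet> x))"
        by (simp add: matrix_vector_mult_add_rdistrib outer_vector inner_add_right inner_commute)
      moreover have "2 * \<bar>(u \<bullet> x) * (w \<bullet> x)\<bar> \<le> (u \<bullet> x)\<^sup>2 + (w \<bullet> x)\<^sup>2"
        using sum_squares_bound[of "\<bar>u \<bullet> x\<bar>" "\<bar>w \<bullet> x\<bar>"] by (simp add: abs_mult)
      ultimately show ?thesis using mem[OF uw(1)] mem[OF uw(2)] by simp
    qed
    then show "outer u w + outer w u \<in> ?P" by blast
  qed
  then show ?thesis using assms(2) by blast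
qed

lemma symmetric_span_mult_eq:
  fixes Q :: "real^'n^'n"
  assumes "\<And>w. w \<in> S \<Longrightarrow> w v* Q = w" "D \<in> symmetric_span S"
  shows "D ** Q = D"
proof -
  have "symmetric_span S \<subseteq> {D. D ** Q = D}"
    by (rule symmetric_span_subset)
      (auto simp: subspace_def linear_0[OF linear_matrix_mult_left]
        linear_add[OF linear_matrix_mult_left] linear_scale[OF linear_matrix_mult_left]
        outer_mult assms(1))
  then show ?thesis using assms(2) by blast
qed

lemma card_ordered_pairs: "2 * card {(i, j). i \<le> j \<and> j < (s::nat)} = s * (s + 1)"
proof -
  have "{(i, j). i \<le> j \<and> j < s} = prod.swap ` (SIGMA j:{..<s}. {..j})" by force
  then have "card {(i, j). i \<le> j \<and> j < s} = (\<Sum>j<s. j + 1)"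
    by (simp add: card_image)
  also have "2 * \<dots> = s * (s + 1)" by (induction s) auto
  finally show ?thesis .
qed

text \<open>
  The matrices \<open>e\<^sub>i e\<^sub>j\<^sup>T + e\<^sub>j e\<^sub>i\<^sup>T\<close> with \<open>i \<le> j\<close> are nonzero and pairwise orthogonal, and
  there are \<open>s (s + 1) / 2\<close> of them.
\<close>

lemma dim_symmetric_span:
  assumes S: "finite S" "pairwise orthogonal S" "\<And>b. b \<in> S \<Longrightarrow> norm b = 1"
  shows "card S * (card S + 1) \<le> 2 * dim (symmetric_span S)"
proof -
  let ?s = "card S"
  obtain e where e: "bij_betw e {..<?s} S"
    using ex_bij_betw_nat_finite[OF S(1)] by (auto simp: atLeast0LessThan)
  have eS: "e i \<in> S" if "i < ?s" for i using e that by (auto simp: bij_betw_def)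
  have delta: "e i \<bullet> e j = (if i = j then 1 else 0)" if "i < ?s" "j < ?s" for i j
  proof (cases "i = j")
    case False
    then have "e i \<noteq> e j" using e that by (auto simp: bij_betw_def inj_on_def)
    then show ?thesis using S(2) eS that False by (auto simp: pairwise_def orthogonal_def)
  qed (use S(3) eS that in \<open>simp add: norm_eq_1\<close>)
  define g where "g = (\<lambda>(i, j). outer (e i) (e j) + outer (e j) (e i))"
  let ?P = "{(i, j). i \<le> j \<and> j < ?s}"
  have gg: "g p \<bullet> g p' = 0" if "p \<in> ?P" "p' \<in> ?P" "p \<noteq> p'" for p p'
    using that
    by (auto simp: g_def inner_add_left inner_add_right inner_outer_outer delta split: if_splits)
  have g1: "g p \<bullet> g p \<noteq> 0" if "p \<in> ?P" for p
    using that
    by (auto simp: g_def inner_add_left inner_add_right inner_outer_outer delta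
        simp del: inner_eq_zero_iff split: if_splits)
  have "inj_on g ?P"
  proof (rule inj_onI, rule ccontr)
    fix p p' assume p: "p \<in> ?P" "p' \<in> ?P" "g p = g p'" "p \<noteq> p'"
    have "g p \<bullet> g p' = 0" using p(1,2,4) by (rule gg)
    then show False using g1[OF p(1)] p(3) by simp
  qed
  then have "card ?P = card (g ` ?P)" by (simp add: card_image)
  also have "\<dots> \<le> dim (symmetric_span S)"
  proof (rule independent_card_le_dim)
    show "g ` ?P \<subseteq> symmetric_span S"
      unfolding symmetric_span_def g_def using eS by (fastforce intro!: span_base)
    show "independent (g ` ?P)"
      using gg g1 by (intro pairwise_orthogonal_independent)
        (fastforce simp: pairwise_def orthogonal_def)+
  qed
  finally show ?thesis using card_ordered_pairs[of ?s] by simp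
qed

lemma subspace_meets_orthogonal_complement:
  fixes W :: "'a::euclidean_space set"
  assumes W: "subspace W" and K: "finite K" "card K < dim W"
  obtains x where "x \<in> W" "x \<noteq> 0" "\<And>c. c \<in> K \<Longrightarrow> c \<bullet> x = 0"
proof -
  let ?T = "{y \<in> UNIV. \<forall>c\<in>span K. orthogonal c y}"
  have T: "subspace ?T"
    by (auto simp: subspace_def orthogonal_def inner_add_right)
  have "dim ?T + dim (span K) = DIM('a)"
    using dim_subspace_orthogonal_to_vectors[of "span K" UNIV] by simp
  moreover have "dim (span K) \<le> card K" using K by (simp add: dim_le_card')
  moreover have "dim {x + y |x y. x \<in> W \<and> y \<in> ?T} + dim (W \<inter> ?T) = dim W + dim ?T"
    by (rule dim_sums_Int[OF W T])
  moreover have "dim {x + y |x y. x \<in> W \<and> y \<in> ?T} \<le> DIM('a)" by (rule dim_subset_UNIV)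
  ultimately have "dim (W \<inter> ?T) \<noteq> 0" using K by linarith
  then obtain x where "x \<in> W \<inter> ?T" "x \<noteq> 0" by (auto simp: dim_eq_0)
  then show thesis using that by (auto simp: orthogonal_def span_base)
qed

section \<open>Perturbing the positive factor\<close>

text \<open>
  In an eigenbasis of \<open>T\<close> the inner product of \<open>T V\<close> with a contraction \<open>Y\<close> is a sum of eigenvalues
  weighted by the inner products of the rows of \<open>V\<close> and \<open>Y\<close>, which are at most \<open>1\<close>. So it is
  at most the trace of \<open>T\<close>.
\<close>

lemma psd_mult_contraction_mem_ball:
  fixes T :: "real^'n^'n" and V :: "real^'p^'n"
  assumes sym: "transpose T = T"
    and psd: "\<And>x. 0 \<le> x \<bullet> (T *v x)" and le: "\<And>x. x \<bullet> (T *v x) \<le> x \<bullet> x"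
    and tr: "mat 1 \<bullet> T \<le> real k" and V: "contraction V"
  shows "T ** V \<in> nuclear_spectral_ball k"
proof -
  obtain B where B: "orthonormal_basis B" and "\<And>b. b \<in> B \<Longrightarrow> \<exists>c. T *v b = c *\<^sub>R b"
    using symmetric_matrix_eigenbasis[OF sym] by blast
  then obtain c where c: "\<And>b. b \<in> B \<Longrightarrow> T *v b = c b *\<^sub>R b" by metis
  have row: "b v* T = c b *\<^sub>R b" if "b \<in> B" for b
    using c[OF that] sym by (metis transpose_matrix_vector)
  have nb: "norm b = 1" "b \<bullet> b = 1" if "b \<in> B" for b
    using B that by (auto simp: orthonormal_basis_def norm_eq_1)
  have c01: "0 \<le> c b" "c b \<le> 1" if "b \<in> B" for b
    using psd[of b] le[of b] by (simp_all add: c that nb)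
  have "singular_basis T B"
    using B by (auto simp: singular_basis_def row c nb matrix_vector_mult_scaleR power2_eq_square)
  then have "contraction T"
    using c01 by (simp add: contraction_iff_singular row nb)
  then have "contraction (T ** V)" using V by (rule contraction_mult)
  moreover have "(T ** V) \<bullet> Y \<le> real k" if Y: "contraction Y" for Y
  proof -
    have "(T ** V) \<bullet> Y = (\<Sum>b\<in>B. c b * ((b v* V) \<bullet> (b v* Y)))"
      unfolding inner_matrix_eq_sum[OF B]
      by (rule sum.cong) (simp_all add: row scaleR_vector_matrix_assoc flip: vector_matrix_mul_assoc)
    also have "\<dots> \<le> (\<Sum>b\<in>B. c b)"
    proof (rule sum_mono)
      fix b assume b: "b \<in> B"
      have "(b v* V) \<bullet> (b v* Y) \<le> norm (b v* V) * norm (b v* Y)" by (rule norm_cauchy_schwarz)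
      also have "\<dots> \<le> 1 * 1"
        using contraction_row[OF V, of b] contraction_row[OF Y, of b] nb[OF b]
        by (intro mult_mono) auto
      finally show "c b * ((b v* V) \<bullet> (b v* Y)) \<le> c b"
        using c01[OF b] by (simp add: mult_left_le)
    qed
    also have "\<dots> = mat 1 \<bullet> T" by (simp add: inner_trace[OF B] row nb)
    finally show ?thesis using tr by simp
  qed
  ultimately show ?thesis by (simp add: mem_nuclear_spectral_ball)
qed

text \<open>
  The singular vectors along which the positive factor has room both above \<open>0\<close> and below the
  identity.
\<close>

definition fractional_vectors :: "real^'p^'n \<Rightarrow> (real^'n) set \<Rightarrow> (real^'n) set" where
  "fractional_vectors X B = {b\<in>B. 0 < norm (b v* X) \<and> norm (b v* X) < 1}"

text \<open>
  On the span of the fractional vectors the positive factor lies between \<open>\<delta>\<close> and \<open>1 - \<delta>\<close> for some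
  \<open>\<delta> > 0\<close>, and the quadratic form of \<open>t D\<close> is bounded by \<open>\<delta>\<close> for small \<open>t\<close>.
\<close>

lemma symmetric_perturbation_mem_ball:
  fixes X :: "real^'p^'n"
  assumes X: "X \<in> nuclear_spectral_ball k" and B: "singular_basis X B"
    and D: "D \<in> symmetric_span (fractional_vectors X B)" and tr: "mat 1 \<bullet> D = 0"
  obtains \<epsilon> where "\<epsilon> > 0"
    "\<And>t. \<bar>t\<bar> \<le> \<epsilon> \<Longrightarrow> X + t *\<^sub>R (D ** polar_factor X B) \<in> nuclear_spectral_ball k"
proof -
  let ?S = "fractional_vectors X B" and ?T = "positive_factor X B" and ?V = "polar_factor X B"
  let ?q = "\<lambda>x. \<Sum>b\<in>?S. (b \<bullet> x)\<^sup>2" and ?\<sigma> = "\<lambda>b. norm (b v* X)"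
  note onb = singular_basis_onb[OF B]
  have finB: "finite B" by (rule singular_basis_finite[OF B])
  have SB: "?S \<subseteq> B" by (auto simp: fractional_vectors_def)
  then have finS: "finite ?S" using finB finite_subset by blast
  have \<sigma>1: "?\<sigma> b \<le> 1" if "b \<in> B" for b
    using X that by (auto simp: nuclear_spectral_ball_def spectral_norm_le_iff[OF B])
  \<comment> \<open>The element \<open>1\<close> keeps the minimum well defined when there is no fractional vector.\<close>
  define \<delta> where "\<delta> = Min (insert 1 ((\<lambda>b. min (?\<sigma> b) (1 - ?\<sigma> b)) ` ?S))"
  have "\<delta> > 0" using finS by (auto simp: \<delta>_def fractional_vectors_def)
  have \<delta>: "\<delta> \<le> ?\<sigma> b" "\<delta> \<le> 1 - ?\<sigma> b" if "b \<in> ?S" for b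
  proof -
    have "\<delta> \<le> min (?\<sigma> b) (1 - ?\<sigma> b)" unfolding \<delta>_def using finS that by (intro Min_le) auto
    then show "\<delta> \<le> ?\<sigma> b" "\<delta> \<le> 1 - ?\<sigma> b" by auto
  qed
  obtain M where M: "\<And>x. \<bar>x \<bullet> (D *v x)\<bar> \<le> M * ?q x"
    using symmetric_span_quadratic_bound[OF finS D] by blast
  define \<epsilon> where "\<epsilon> = \<delta> / (\<bar>M\<bar> + 1)"
  have "\<epsilon> > 0" using \<open>\<delta> > 0\<close> by (simp add: \<epsilon>_def)
  have "X + t *\<^sub>R (D ** ?V) \<in> nuclear_spectral_ball k" if t: "\<bar>t\<bar> \<le> \<epsilon>" for t
  proof -
    let ?R = "?T + t *\<^sub>R D"
    have small: "\<bar>t * (x \<bullet> (D *v x))\<bar> \<le> \<delta> * ?q x" for x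
    proof -
      have q: "0 \<le> ?q x" by (simp add: sum_nonneg)
      have "\<bar>t * (x \<bullet> (D *v x))\<bar> \<le> \<epsilon> * (M * ?q x)"
        unfolding abs_mult using t M[of x] \<open>\<epsilon> > 0\<close> by (intro mult_mono) auto
      also have "\<dots> \<le> \<epsilon> * ((\<bar>M\<bar> + 1) * ?q x)"
        using q \<open>\<epsilon> > 0\<close> by (intro mult_left_mono mult_right_mono) auto
      also have "\<dots> = \<delta> * ?q x" by (simp add: \<epsilon>_def)
      finally show ?thesis .
    qed
    have quad: "x \<bullet> (?R *v x) = (\<Sum>b\<in>B. ?\<sigma> b * (b \<bullet> x)\<^sup>2) + t * (x \<bullet> (D *v x))" for x
      by (simp add: matrix_vector_mult_add_rdistrib inner_add_right positive_factor_quadratic[OF onb]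
          scaleR_matrix_vector_assoc[symmetric])
    have "?R ** ?V \<in> nuclear_spectral_ball k"
    proof (rule psd_mult_contraction_mem_ball)
      show "transpose ?R = ?R"
        by (simp add: linear_add[OF linear_transpose] linear_scale[OF linear_transpose]
            transpose_positive_factor transpose_symmetric_span[OF D])
      show "0 \<le> x \<bullet> (?R *v x)" for x
      proof -
        have "\<delta> * ?q x \<le> (\<Sum>b\<in>?S. ?\<sigma> b * (b \<bullet> x)\<^sup>2)"
          unfolding sum_distrib_left using \<delta> by (intro sum_mono mult_right_mono) auto
        also have "\<dots> \<le> (\<Sum>b\<in>B. ?\<sigma> b * (b \<bullet> x)\<^sup>2)"
          using SB finB by (intro sum_mono2) auto
        finally show ?thesis using small[of x] quad[of x] by linarith
      qed
      show "x \<bullet> (?R *v x) \<le> x \<bullet> x" for x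
      proof -
        have "\<delta> * ?q x \<le> (\<Sum>b\<in>?S. (1 - ?\<sigma> b) * (b \<bullet> x)\<^sup>2)"
          unfolding sum_distrib_left using \<delta> by (intro sum_mono mult_right_mono) auto
        also have "\<dots> \<le> (\<Sum>b\<in>B. (1 - ?\<sigma> b) * (b \<bullet> x)\<^sup>2)"
          using SB finB \<sigma>1 by (intro sum_mono2) auto
        also have "\<dots> = x \<bullet> x - (\<Sum>b\<in>B. ?\<sigma> b * (b \<bullet> x)\<^sup>2)"
          by (simp add: parseval[OF onb, of x x] left_diff_distrib sum_subtractf power2_eq_square)
        finally show ?thesis using small[of x] quad[of x] by linarith
      qed
      have "mat 1 \<bullet> ?T = nuclear_norm X"
        unfolding inner_trace[OF onb] nuclear_norm_eq[OF B]
        by (rule sum.cong)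
          (simp_all add: positive_factor_row[OF onb] orthonormal_basis_inner[OF onb])
      then show "mat 1 \<bullet> ?R \<le> real k"
        using X tr by (simp add: inner_add_right nuclear_spectral_ball_def)
      show "contraction ?V" by (rule contraction_polar_factor[OF B])
    qed
    then show ?thesis
      by (simp add: linear_add[OF linear_matrix_mult_left] linear_scale[OF linear_matrix_mult_left]
          polar_decomposition[OF onb])
  qed
  with that \<open>\<epsilon> > 0\<close> show thesis by blast
qed

text \<open>
  A dimension count: \<open>card K\<close> constraints and the trace condition cannot exhaust a space of
  symmetric matrices of dimension \<open>s (s + 1) / 2 > card K + 1\<close>.
\<close>

lemma perturbation_direction_exists:
  fixes X :: "real^'p^'n" and K :: "(real^'p^'n) set"
  assumes X: "X \<in> nuclear_spectral_ball k" and B: "singular_basis X B" and K: "finite K"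
    and large: "2 * (card K + 1) < card (fractional_vectors X B) * (card (fractional_vectors X B) + 1)"
  obtains D where "D \<noteq> 0" "\<And>c. c \<in> K \<Longrightarrow> c \<bullet> D = 0"
    "X + D \<in> nuclear_spectral_ball k" "X - D \<in> nuclear_spectral_ball k"
proof -
  let ?S = "fractional_vectors X B" and ?V = "polar_factor X B"
  note onb = singular_basis_onb[OF B]
  have SB: "?S \<subseteq> B" by (auto simp: fractional_vectors_def)
  have orthS: "finite ?S" "pairwise orthogonal ?S" "\<And>b. b \<in> ?S \<Longrightarrow> norm b = 1"
    using onb SB by (auto simp: orthonormal_basis_def intro: finite_subset pairwise_subset)
  \<comment> \<open>The constraint \<open>mat 1\<close> fixes the trace, hence the bound on the nuclear norm.\<close>
  let ?K = "insert (mat 1) ((\<lambda>c. c ** transpose ?V) ` K)"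
  have "card ?K \<le> card K + 1"
    using K card_image_le[OF K, of "\<lambda>c. c ** transpose ?V"] by (simp add: card_insert_if)
  moreover have "card ?S * (card ?S + 1) \<le> 2 * dim (symmetric_span ?S)"
    by (rule dim_symmetric_span) (use orthS in auto)
  ultimately have "card ?K < dim (symmetric_span ?S)"
    using large by (meson le_less_trans less_le_trans mult_le_mono2 nat_mult_less_cancel1 zero_less_numeral)
  moreover have "finite ?K" using K by simp
  moreover have "subspace (symmetric_span ?S)" by (simp add: symmetric_span_def)
  ultimately obtain D where D: "D \<in> symmetric_span ?S" "D \<noteq> 0" and orth: "\<And>c. c \<in> ?K \<Longrightarrow> c \<bullet> D = 0"
    by (metis subspace_meets_orthogonal_complement)
  obtain \<epsilon> where \<epsilon>: "\<epsilon> > 0"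
    and mem: "\<And>t. \<bar>t\<bar> \<le> \<epsilon> \<Longrightarrow> X + t *\<^sub>R (D ** ?V) \<in> nuclear_spectral_ball k"
    using symmetric_perturbation_mem_ball[OF X B D(1)] orth by blast
  \<comment> \<open>Multiplication by \<open>?V\<close> does not lose \<open>D\<close>: on fractional vectors it is an isometry.\<close>
  have "b v* (?V ** transpose ?V) = b" if "b \<in> ?S" for b
    using that by (auto simp: fractional_vectors_def polar_factor_row[OF onb] polar_factor_vector[OF B]
        simp flip: vector_matrix_mul_assoc)
  then have "D ** (?V ** transpose ?V) = D" using D(1) by (rule symmetric_span_mult_eq)
  then have "D ** ?V \<noteq> 0" using D(2) by (metis matrix_mul_assoc linear_0[OF linear_matrix_mult_left])
  show thesis
  proof (rule that)
    show "\<epsilon> *\<^sub>R (D ** ?V) \<noteq> 0" using \<epsilon> \<open>D ** ?V \<noteq> 0\<close> by simp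
    show "c \<bullet> (\<epsilon> *\<^sub>R (D ** ?V)) = 0" if "c \<in> K" for c
      using orth that by (simp add: inner_matrix_mult)
    show "X + \<epsilon> *\<^sub>R (D ** ?V) \<in> nuclear_spectral_ball k" using mem[of \<epsilon>] \<epsilon> by simp
    show "X - \<epsilon> *\<^sub>R (D ** ?V) \<in> nuclear_spectral_ball k" using mem[of "- \<epsilon>"] \<epsilon> by simp
  qed
qed

section \<open>The rank bound\<close>

text \<open>
  If there is a fractional singular value, it takes up part of the budget \<open>k\<close> for the sum of the
  singular values, and fewer than \<open>k\<close> of them can equal \<open>1\<close>.
\<close>

lemma rank_le_fractional:
  fixes X :: "real^'p^'n"
  assumes X: "X \<in> nuclear_spectral_ball k" and B: "singular_basis X B"
  shows "rank X \<le> k \<or> rank X + 1 \<le> k + card (fractional_vectors X B)"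
proof -
  let ?S = "fractional_vectors X B" and ?\<sigma> = "\<lambda>b. norm (b v* X)"
  let ?U = "{b\<in>B. ?\<sigma> b = 1}"
  have fin: "finite B" by (rule singular_basis_finite[OF B])
  have \<sigma>1: "?\<sigma> b \<le> 1" if "b \<in> B" for b
    using X that by (auto simp: nuclear_spectral_ball_def spectral_norm_le_iff[OF B])
  have split: "{b\<in>B. b v* X \<noteq> 0} = ?U \<union> ?S"
    using \<sigma>1 by (force simp: fractional_vectors_def order_less_le)
  have finS: "finite ?S" using fin by (simp add: fractional_vectors_def)
  have disj: "?U \<inter> ?S = {}" by (auto simp: fractional_vectors_def)
  have rank: "rank X = card ?U + card ?S"
    unfolding rank_eq_card_nonzero[OF B] split using fin finS disj by (simp add: card_Un_disjoint)
  have "real (card ?U) + (\<Sum>b\<in>?S. ?\<sigma> b) = (\<Sum>b\<in>?U. ?\<sigma> b) + (\<Sum>b\<in>?S. ?\<sigma> b)" by simp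
  also have "\<dots> = (\<Sum>b\<in>?U \<union> ?S. ?\<sigma> b)"
    using fin finS disj by (simp add: sum.union_disjoint)
  also have "\<dots> \<le> (\<Sum>b\<in>B. ?\<sigma> b)"
    using fin by (intro sum_mono2) (auto simp: fractional_vectors_def)
  also have "\<dots> \<le> real k"
    using X by (simp add: nuclear_spectral_ball_def nuclear_norm_eq[OF B])
  finally have le: "real (card ?U) + (\<Sum>b\<in>?S. ?\<sigma> b) \<le> real k" .
  show ?thesis
  proof (cases "?S = {}")
    case True
    then show ?thesis using le rank by simp
  next
    case False
    then have "0 < (\<Sum>b\<in>?S. ?\<sigma> b)"
      using finS by (intro sum_pos) (auto simp: fractional_vectors_def)
    then have "card ?U < k" using le by linarith
    then show ?thesis using rank by simp
  qed
qed

lemma rank_bound_if_no_direction: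
  fixes X :: "real^'p^'n"
  assumes X: "X \<in> nuclear_spectral_ball k" and K: "finite K"
    and rigid: "\<And>D. (\<And>c. c \<in> K \<Longrightarrow> c \<bullet> D = 0) \<Longrightarrow> X + D \<in> nuclear_spectral_ball k \<Longrightarrow>
      X - D \<in> nuclear_spectral_ball k \<Longrightarrow> D = 0"
  obtains s where "s * (s + 1) \<le> 2 * (card K + 1)" "rank X \<le> k \<or> rank X + 1 \<le> k + s"
proof -
  obtain B where B: "singular_basis X B" by (rule singular_basis_exists)
  let ?s = "card (fractional_vectors X B)"
  have "?s * (?s + 1) \<le> 2 * (card K + 1)"
    using perturbation_direction_exists[OF X B K] rigid by (metis not_le)
  then show thesis using that rank_le_fractional[OF X B] by blast
qed

section \<open>The convex hull\<close>

lemma symmetric_pair_extreme_point: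
  assumes "X extreme_point_of C" "X + D \<in> C" "X - D \<in> C"
  shows "D = (0 :: 'a::euclidean_space)"
proof (rule ccontr)
  assume "D \<noteq> 0"
  have "X + D \<noteq> X - D"
  proof
    assume "X + D = X - D"
    then have "2 *\<^sub>R D = 0" unfolding scaleR_2 by (simp add: eq_diff_eq add.assoc)
    then show False using \<open>D \<noteq> 0\<close> by simp
  qed
  moreover have "midpoint (X + D) (X - D) = X"
    by (simp add: midpoint_def flip: scaleR_2)
  ultimately have "X \<in> open_segment (X + D) (X - D)"
    by (metis midpoint_in_open_segment)
  then show False using assms by (auto simp: extreme_point_of_def)
qed

text \<open>The product \<open>s (s + 1)\<close> takes the value \<open>2\<close> at \<open>s = 1\<close> and jumps to \<open>6\<close> at \<open>s = 2\<close>.\<close>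

lemma pronic_le:
  assumes "s * (s + 1) \<le> m" "m < 6"
  shows "s \<le> (1::nat)"
proof (rule ccontr)
  assume "\<not> s \<le> 1"
  then have "2 * 3 \<le> s * (s + 1)" by (intro mult_le_mono) auto
  then show False using assms by linarith
qed

text \<open>
  Extreme points admit no direction at all. So for them the count runs with no constraint but the trace,
  and allows at most one fractional singular value, which leaves the rank at most \<open>k\<close>.
\<close>

lemma convex_hull_rank_spectral_set:
  "convex hull (rank_spectral_set k) = (nuclear_spectral_ball k :: (real^'p^'n) set)"
proof
  show "convex hull (rank_spectral_set k) \<subseteq> (nuclear_spectral_ball k :: (real^'p^'n) set)"
    by (intro hull_minimal rank_spectral_set_subset convex_nuclear_spectral_ball)
  have "X \<in> rank_spectral_set k" if ext: "X extreme_point_of nuclear_spectral_ball k" for X :: "real^'p^'n"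
  proof -
    have X: "X \<in> nuclear_spectral_ball k" using ext by (simp add: extreme_point_of_def)
    obtain s where s: "s * (s + 1) \<le> 2 * (card ({} :: (real^'p^'n) set) + 1)"
      "rank X \<le> k \<or> rank X + 1 \<le> k + s"
      by (rule rank_bound_if_no_direction[OF X finite.emptyI])
         (use symmetric_pair_extreme_point[OF ext] in auto)
    have "s \<le> 1" using pronic_le[OF s(1)] by simp
    then have "rank X \<le> k" using s(2) by linarith
    then show ?thesis using X by (simp add: rank_spectral_set_def nuclear_spectral_ball_def)
  qed
  then have "convex hull {X. X extreme_point_of nuclear_spectral_ball k} \<subseteq>
      convex hull (rank_spectral_set k :: (real^'p^'n) set)"
    by (intro hull_mono subsetI) simp
  then show "(nuclear_spectral_ball k :: (real^'p^'n) set) \<subseteq> convex hull (rank_spectral_set k)"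
    by (rule ord_eq_le_trans[OF Krein_Milman_Minkowski[OF compact_nuclear_spectral_ball
          convex_nuclear_spectral_ball]])
qed

section \<open>The fair optimisation problem\<close>

lemma continuous_on_Min_image:
  fixes f :: "'i \<Rightarrow> 'a::topological_space \<Rightarrow> real"
  assumes "finite I" "I \<noteq> {}" "\<And>i. i \<in> I \<Longrightarrow> continuous_on S (f i)"
  shows "continuous_on S (\<lambda>x. Min ((\<lambda>i. f i x) ` I))"
  using assms
proof (induction I rule: finite_ne_induct)
  case (insert i I)
  then have "(\<lambda>x. Min ((\<lambda>i. f i x) ` insert i I)) = (\<lambda>x. min (f i x) (Min ((\<lambda>i. f i x) ` I)))"
    by (intro ext) simp
  then show ?case using insert by (auto intro!: continuous_on_min)
qed simp

lemma fair_relaxed_optimum_exists: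
  fixes A :: "nat \<Rightarrow> real^'p^'n"
  assumes m: "1 \<le> m"
  obtains v X0 where "optimal_solution (fair_svd_relaxed A m k) (v, X0)"
proof -
  let ?C = "nuclear_spectral_ball k :: (real^'p^'n) set"
  let ?g = "\<lambda>X. Min ((\<lambda>i. A i \<bullet> X) ` {1..m})"
  have "continuous_on ?C ?g"
    using m by (intro continuous_on_Min_image continuous_on_inner continuous_on_const
        continuous_on_id) auto
  moreover have "?C \<noteq> {}" using zero_mem_nuclear_spectral_ball by blast
  ultimately have "\<exists>Y\<in>?C. \<forall>X\<in>?C. ?g X \<le> ?g Y"
    by (intro continuous_attains_sup compact_nuclear_spectral_ball)
  then obtain X0 where X0: "X0 \<in> ?C" and max: "\<And>X. X \<in> ?C \<Longrightarrow> ?g X \<le> ?g X0"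
    by blast
  have feas: "(z, X) \<in> fair_svd_relaxed A m k \<longleftrightarrow> X \<in> ?C \<and> z \<le> ?g X" for z X
    using m by (simp add: fair_svd_relaxed_def fair_feasible_def convex_hull_rank_spectral_set)
  have "optimal_solution (fair_svd_relaxed A m k) (?g X0, X0)"
    using X0 max by (force simp: optimal_solution_def is_arg_max_def feas)
  then show thesis by (rule that)
qed

lemma optimal_solution_le:
  assumes "optimal_solution F (v, Y)" "(w, X) \<in> F"
  shows "w \<le> v"
  using assms by (force simp: optimal_solution_def is_arg_max_def)

text \<open>
  Take an extreme point of the set \<open>E\<close> of optimal matrices. Constraining directions to be
  orthogonal to the differences \<open>A i - A 1\<close>, rather than to all \<open>A i\<close>, saves one constraint:
  along such a direction all objectives change by a common amount \<open>d\<close>, and moving in both senses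
  shows \<open>d = 0\<close> by optimality, so the segment stays in \<open>E\<close>.
\<close>

lemma fair_relaxed_low_rank_optimum:
  fixes A :: "nat \<Rightarrow> real^'p^'n"
  assumes m: "1 \<le> m"
  obtains v X s where "optimal_solution (fair_svd_relaxed A m k) (v, X)"
    "s * (s + 1) \<le> 2 * m" "rank X \<le> k \<or> rank X + 1 \<le> k + s"
proof -
  let ?C = "nuclear_spectral_ball k :: (real^'p^'n) set"
  obtain v X0 where opt: "optimal_solution (fair_svd_relaxed A m k) (v, X0)"
    using fair_relaxed_optimum_exists[OF m] by blast
  have feas: "(z, X) \<in> fair_svd_relaxed A m k \<longleftrightarrow> X \<in> ?C \<and> (\<forall>i\<in>{1..m}. z \<le> A i \<bullet> X)" for z X
    by (simp add: fair_svd_relaxed_def fair_feasible_def convex_hull_rank_spectral_set)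
  let ?E = "?C \<inter> (\<Inter>i\<in>{1..m}. {X. A i \<bullet> X \<ge> v})"
  have "compact ?E"
    by (intro compact_Int_closed compact_nuclear_spectral_ball closed_INT)
       (auto simp: closed_halfspace_ge)
  moreover have "convex ?E"
    by (intro convex_Int convex_nuclear_spectral_ball convex_INT) (auto simp: convex_halfspace_ge)
  moreover have "X0 \<in> ?E"
    using opt feas by (auto simp: optimal_solution_def is_arg_max_def)
  ultimately obtain X where ext: "X extreme_point_of ?E"
    using extreme_point_exists_convex[of ?E] by blast
  then have XE: "X \<in> ?E" by (simp add: extreme_point_of_def)
  then have feasX: "(v, X) \<in> fair_svd_relaxed A m k" by (auto simp: feas)
  have optX: "optimal_solution (fair_svd_relaxed A m k) (v, X)"
    using opt feasX by (simp add: optimal_solution_def is_arg_max_def)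
  let ?K = "(\<lambda>i. A i - A 1) ` {2..m}"
  have rigid: "D = 0" if K: "\<And>c. c \<in> ?K \<Longrightarrow> c \<bullet> D = 0" and mem: "X + D \<in> ?C" "X - D \<in> ?C" for D
  proof -
    define d where "d = A 1 \<bullet> D"
    have same: "A i \<bullet> D = d" if "i \<in> {1..m}" for i
    proof (cases "i = 1")
      case False
      then have "A i - A 1 \<in> ?K" using that by auto
      from K[OF this] show ?thesis by (simp add: inner_diff_left d_def)
    qed (simp add: d_def)
    have ge: "v \<le> A i \<bullet> X" if "i \<in> {1..m}" for i using feasX that by (simp add: feas)
    have "(v + d, X + D) \<in> fair_svd_relaxed A m k"
      using mem(1) ge same by (simp add: feas inner_add_right)
    moreover have "(v - d, X - D) \<in> fair_svd_relaxed A m k"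
      using mem(2) ge same by (simp add: feas inner_diff_right)
    ultimately have "d = 0"
      using optimal_solution_le[OF opt, of "v + d"] optimal_solution_le[OF opt, of "v - d"]
      by fastforce
    then have "X + D \<in> ?E" "X - D \<in> ?E"
      using mem ge same by (auto simp: inner_add_right inner_diff_right)
    then show ?thesis using symmetric_pair_extreme_point[OF ext] by blast
  qed
  have "card ?K + 1 \<le> m"
    using card_image_le[of "{2..m}" "\<lambda>i. A i - A 1"] m by simp
  moreover obtain s where "s * (s + 1) \<le> 2 * (card ?K + 1)" "rank X \<le> k \<or> rank X + 1 \<le> k + s"
    using XE by (auto intro: rank_bound_if_no_direction[of X k ?K, OF _ _ rigid])
  ultimately have "s * (s + 1) \<le> 2 * m" "rank X \<le> k \<or> rank X + 1 \<le> k + s"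
    by (meson mult_le_mono2 order_trans, blast)
  with that optX show thesis by blast
qed

text \<open>Complete the square: \<open>s (s + 1) + 1/4 = (s + 1/2)\<^sup>2\<close>.\<close>

lemma pronic_bound_floor:
  assumes "s * (s + 1) \<le> 2 * m"
  shows "int s - 1 \<le> \<lfloor>sqrt (2 * real m + 1/4) - 3/2\<rfloor>"
proof -
  have "real (s * (s + 1)) \<le> real (2 * m)" using assms by (rule of_nat_mono)
  then have "(real s + 1/2)\<^sup>2 \<le> 2 * real m + 1/4"
    by (simp add: power2_eq_square algebra_simps)
  then have "real s + 1/2 \<le> sqrt (2 * real m + 1/4)" by (rule real_le_rsqrt)
  then show ?thesis by (simp add: le_floor_iff)
qed

theorem corollary4:
  fixes A :: "nat \<Rightarrow> real^'p^'n" and k m :: nat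
  assumes "1 \<le> k" and "k \<le> CARD('n)" and "CARD('n) \<le> CARD('p)" and "1 \<le> m"
  shows "convex hull (rank_spectral_set k) =
           {X :: real^'p^'n. nuclear_norm X \<le> real k \<and> spectral_norm X \<le> 1} \<and>
         (\<exists>z X. optimal_solution (fair_svd_relaxed A m k) (z, X) \<and>
           int (rank X) \<le> int k + \<lfloor>sqrt (2 * real m + 1/4) - 3/2\<rfloor>) \<and>
         (m \<le> 2 \<longrightarrow>
           (\<exists>v. has_optimal_value (fair_svd A m k) v \<and>
                has_optimal_value (fair_svd_relaxed A m k) v))"
proof -
  obtain v X s where opt: "optimal_solution (fair_svd_relaxed A m k) (v, X)"
    and s: "s * (s + 1) \<le> 2 * m" "rank X \<le> k \<or> rank X + 1 \<le> k + s"
    using fair_relaxed_low_rank_optimum[OF assms(4)] by blast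
  have "0 \<le> \<lfloor>sqrt (2 * real m + 1/4) - 3/2\<rfloor>"
    using pronic_bound_floor[of 1 m] assms(4) by simp
  then have "int (rank X) \<le> int k + \<lfloor>sqrt (2 * real m + 1/4) - 3/2\<rfloor>"
    using s(2) pronic_bound_floor[OF s(1)] by linarith
  moreover have "has_optimal_value (fair_svd A m k) v \<and> has_optimal_value (fair_svd_relaxed A m k) v"
    if "m \<le> 2"
  proof -
    have "s \<le> 1" using pronic_le[OF s(1)] that by simp
    then have "rank X \<le> k" using s(2) by linarith
    have XC: "X \<in> nuclear_spectral_ball k" "\<forall>i\<in>{1..m}. v \<le> A i \<bullet> X"
      using opt by (auto simp: optimal_solution_def is_arg_max_def fair_svd_relaxed_def
          fair_feasible_def convex_hull_rank_spectral_set)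
    then have "(v, X) \<in> fair_svd A m k"
      using \<open>rank X \<le> k\<close>
      by (simp add: fair_svd_def fair_feasible_def rank_spectral_set_def nuclear_spectral_ball_def)
    moreover have "fair_svd A m k \<subseteq> fair_svd_relaxed A m k"
      using hull_subset[of "rank_spectral_set k" convex]
      by (auto simp: fair_svd_def fair_svd_relaxed_def fair_feasible_def)
    ultimately have "optimal_solution (fair_svd A m k) (v, X)"
      using opt by (auto simp: optimal_solution_def is_arg_max_def)
    then show ?thesis using opt by (auto simp: has_optimal_value_def)
  qed
  ultimately show ?thesis
    using opt convex_hull_rank_spectral_set[where 'n='n and 'p='p, of k]
    by (auto simp: nuclear_spectral_ball_def)
qed

end
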